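(* Let $n,b$ be integers with $1\le b\le n$. The double-level policy $\pi(s,r)$, with $s=(s_1,s_2)$ and $r=(r_1,r_2)$, given by integer rank levels $1\le r_1<r_2\le b$ and integer position thresholds $r_1\le s_1<s_2\le n-1$, has winning probability $$\begin{aligned} P_{\rm DLP}(\pi(s,r)) ={}& \sum_{i=s_1+1}^{s_2}\frac{(s_1)_{r_1}}{(i-1)_{r_1}}\left(\frac{r_1}{n} + \frac{1}{n} \sum_{j=r_1+1}^b \sum_{k=1}^{r_1}\frac{\binom{j-1}{k-1}\binom{n-j}{i-k}}{\binom{n-1}{i-1}}\right)\\ & + \sum_{i=s_2+1}^{n-1}\frac{(s_1)_{r_1}\,(s_2-r_1)_{r_2-r_1}}{(i-1)_{r_2}}\left(\frac{r_2}{n} + \frac{1}{n} \sum_{j=r_2+1}^b \sum_{k=1}^{r_2}\frac{\binom{j-1}{k-1}\binom{n-j}{i-k}}{\binom{n-1}{i-1}}\right)\\ & + \frac{(s_1)_{r_1}\,(s_2-r_1)_{r_2-r_1}}{(n-1)_{r_2}}\,\frac{b}{n}. \end{aligned}$$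
   Context: $n$ objects arrive one by one in uniformly random order. $X_i\in\{1,\ldots,n\}$ is the absolute rank of the $i$-th arriving object (rank 1 is best), so $(X_1,\ldots,X_n)$ is a uniformly random permutation of $\{1,\ldots,n\}$. $Y_i=\#\{k\le i: X_k\le X_i\}$ is the relative rank of the $i$-th object among the first $i$ objects. Double-level policy $\pi(s,r)$ with position thresholds $s=(s_1,s_2)$ and rank levels $r=(r_1,r_2)$: no object at positions $1,\ldots,s_1$ is picked; the first object at a position $i\in\{s_1+1,\ldots,s_2\}$ with $Y_i\le r_1$ is picked; if there is none, the first object at a position $i\in\{s_2+1,\ldots,n-1\}$ with $Y_i\le r_2$ is picked; if there is none either, the last object (position $n$) is picked, whatever its rank. The policy wins if the picked object, at position $i$, has $X_i\le b$ (it is one of the $b$ best). $P_{\rm DLP}(\pi(s,r))$ is the probability of winning. Notation: $(x)_m=x(x-1)\cdots(x-m+1)$ is the falling factorial. Binomial coefficients $\binom{m}{l}$ with $m\ge 0$ are zero if $l<0$ or $l>m$. Empty sums are zero.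
   Formalization: If s_2<r_2, the coefficients of the second sum and of the last term can be 0/0 (e.g. n=4, b=3, r=(1,3), s=(1,2), i=3); writing m for i-1 or n-1, where m<r_2 they are read as (s_1)_{r_1}/(s_2)_{r_1} if m=s_2 and as 0 if m>s_2. *)

theory Defs
  imports "HOL-Probability.Probability" "HOL-Combinatorics.Combinatorics"
begin

definition ffact :: "real \<Rightarrow> nat \<Rightarrow> real" where
  "ffact x m = (\<Prod>k<m. x - real k)"

text \<open>Binomial coefficient with an integer lower index, zero if that index is negative:
  a difference of naturals in the lower index would be truncated to zero and give the value one.\<close>

definition zbinom :: "nat \<Rightarrow> int \<Rightarrow> real" where
  "zbinom m l = (if l < 0 then 0 else real (m choose nat l))"

text \<open>An arrival order of \<open>n\<close> objects is a permutation \<open>X\<close> of \<open>{1..n}\<close>, where \<open>X i\<close> is the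
  absolute rank of the \<open>i\<close>-th object to arrive.\<close>

definition rel_rank :: "(nat \<Rightarrow> nat) \<Rightarrow> nat \<Rightarrow> nat" where
  "rel_rank X i = card {k \<in> {1..i}. X k \<le> X i}"

definition dlp_pick :: "nat \<Rightarrow> nat \<times> nat \<Rightarrow> nat \<times> nat \<Rightarrow> (nat \<Rightarrow> nat) \<Rightarrow> nat" where
  "dlp_pick n = (\<lambda>(s\<^sub>1, s\<^sub>2) (r\<^sub>1, r\<^sub>2) X.
     if \<exists>i\<in>{s\<^sub>1+1..s\<^sub>2}. rel_rank X i \<le> r\<^sub>1
     then LEAST i. i \<in> {s\<^sub>1+1..s\<^sub>2} \<and> rel_rank X i \<le> r\<^sub>1
     else if \<exists>i\<in>{s\<^sub>2+1..n-1}. rel_rank X i \<le> r\<^sub>2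
     then LEAST i. i \<in> {s\<^sub>2+1..n-1} \<and> rel_rank X i \<le> r\<^sub>2
     else n)"

definition P_DLP :: "nat \<Rightarrow> nat \<Rightarrow> nat \<times> nat \<Rightarrow> nat \<times> nat \<Rightarrow> real" where
  "P_DLP n b s r =
     measure_pmf.prob (pmf_of_set {X. X permutes {1..n}}) {X. X (dlp_pick n s r X) \<le> b}"

text \<open>The quotient \<open>(s\<^sub>1)\<^bsub>r\<^sub>1\<^esub> (s\<^sub>2 - r\<^sub>1)\<^bsub>r\<^sub>2 - r\<^sub>1\<^esub> / (m)\<^bsub>r\<^sub>2\<^esub>\<close> of falling factorials, for \<open>m \<ge> s\<^sub>2\<close>.
  If \<open>r\<^sub>2 \<le> m\<close>, the denominator is nonzero and the quotient is taken as it stands.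
  If \<open>m < r\<^sub>2\<close>, which can happen only for \<open>s\<^sub>2 < r\<^sub>2\<close>, it has the form \<open>0/0\<close> and is given its meaning
  through \<open>(m)\<^bsub>r\<^sub>2\<^esub> = (m)\<^bsub>r\<^sub>1\<^esub> (m - r\<^sub>1)\<^bsub>r\<^sub>2 - r\<^sub>1\<^esub>\<close>: for \<open>m = s\<^sub>2\<close> the factor \<open>(s\<^sub>2 - r\<^sub>1)\<^bsub>r\<^sub>2 - r\<^sub>1\<^esub>\<close>
  cancels, and for \<open>m > s\<^sub>2\<close> the value is zero, because position \<open>m + 1\<close> is then never reached:
  every object at position \<open>s\<^sub>2 + 1 \<le> r\<^sub>2\<close> has relative rank at most \<open>r\<^sub>2\<close>.
  (The convention \<open>0/0 = 0\<close> of real division would be wrong for \<open>m = s\<^sub>2\<close>.)\<close>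

definition ffact_quot :: "nat \<times> nat \<Rightarrow> nat \<times> nat \<Rightarrow> nat \<Rightarrow> real" where
  "ffact_quot = (\<lambda>(s\<^sub>1, s\<^sub>2) (r\<^sub>1, r\<^sub>2) m.
     if r\<^sub>2 \<le> m
     then ffact (real s\<^sub>1) r\<^sub>1 * ffact (real s\<^sub>2 - real r\<^sub>1) (r\<^sub>2 - r\<^sub>1) / ffact (real m) r\<^sub>2
     else if m = s\<^sub>2 then ffact (real s\<^sub>1) r\<^sub>1 / ffact (real s\<^sub>2) r\<^sub>1
     else 0)"

end

theory Submission
  imports Defs
begin

text \<open>
  The double-level policy is an instance of a policy that accepts the first object whose relative
  rank is at most a level \<open>t i\<close> attached to its position \<open>i\<close>. For every policy of this kind, the
  event of winning is the disjoint union, over the positions \<open>i\<close>, of the events that all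
  objects before position \<open>i\<close> are rejected while the object at position \<open>i\<close> is accepted and is one of
  the \<open>b\<close> best.

  Whether the earlier objects are rejected depends only on their order relative to each other,
  whereas the absolute and relative rank of the object at position \<open>i\<close> depend only on
  which objects came before it, not on their order. The two conditions are therefore independent.
  The number of orderings of \<open>m\<close> objects in which all are rejected is \<open>\<Prod>k=1..m. k - t k\<close>
  (\<open>card_all_rejected\<close>), as one sees by choosing the last object first, and the number of sets of
  predecessors compatible with an object of absolute rank \<open>j\<close> and relative rank \<open>k\<close> is
  hypergeometric (\<open>card_prior_sets\<close>). Together they give the probability of winning at
  position \<open>i\<close> (\<open>prob_first_accepted\<close>).

  The formula is the sum of these probabilities for levels that are constant on each phase: the
  product of the factors \<open>(k - t k)/k\<close> telescopes to quotients of falling factorials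
  (\<open>survival_dlp\<close>), the initial phase contributes nothing, and the last position, which accepts
  everything, contributes its survival probability times \<open>b/n\<close>.
\<close>

section \<open>Orderings in which every object is rejected\<close>

text \<open>Arrival orders are handled as duplicate-free lists over an arbitrary linearly ordered set, because
  the part of an arrival order before a given position ranges over the orderings of a set of ranks
  that need not be an initial segment of the naturals. Positions in lists start at 0, so the object
  at list index \<open>k\<close> is subject to the level \<open>t (Suc k)\<close>.\<close>

definition rank_at :: "'a::linorder list \<Rightarrow> nat \<Rightarrow> nat" where
  "rank_at xs i = card {x \<in> set (take (Suc i) xs). x \<le> xs ! i}"

definition all_rejected :: "(nat \<Rightarrow> nat) \<Rightarrow> 'a::linorder list \<Rightarrow> bool" where
  "all_rejected t xs \<longleftrightarrow> (\<forall>k<length xs. t (Suc k) < rank_at xs k)"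

lemma rank_at_append: "k < length xs \<Longrightarrow> rank_at (xs @ ys) k = rank_at xs k"
  by (simp add: rank_at_def nth_append)

lemma rank_at_length: "rank_at (xs @ a # ys) (length xs) = card {x \<in> insert a (set xs). x \<le> a}"
  by (simp add: rank_at_def)

lemma all_rejected_snoc:
  "all_rejected t (xs @ [a]) \<longleftrightarrow>
     all_rejected t xs \<and> t (Suc (length xs)) < card {x \<in> insert a (set xs). x \<le> a}"
  by (auto simp: all_rejected_def rank_at_append less_Suc_eq rank_at_length[of xs a "[]", simplified])

text \<open>Ranking within \<open>A\<close> is a bijection from \<open>A\<close> onto \<open>{1..card A}\<close>; hence the elements in question
  correspond to \<open>{t<..card A}\<close>.\<close>

lemma card_rank_greater:
  fixes A :: "'a::linorder set"
  assumes "finite A"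
  shows "card {a \<in> A. t < card {x \<in> A. x \<le> a}} = card A - t"
proof -
  define f where "f a = card {x \<in> A. x \<le> a}" for a
  have lt: "f a < f b" if "a \<in> A" "b \<in> A" "a < b" for a b
    unfolding f_def using that assms by (intro psubset_card_mono) force+
  have inj: "inj_on f A"
    by (metis inj_onI lt less_irrefl neqE)
  have "f ` A \<subseteq> {1..card A}"
    using assms by (auto simp: f_def Suc_le_eq card_gt_0_iff intro: card_mono)
  then have "f ` A = {1..card A}"
    by (intro card_subset_eq) (auto simp: card_image[OF inj])
  then have "f ` {a \<in> A. t < f a} = {t<..card A}"
    by (auto simp: set_eq_iff image_iff) (metis Suc_leI atLeastAtMost_iff imageE
        One_nat_def le_zero_eq not_less_eq_eq gr_zeroI less_le_trans zero_less_Suc)+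
  moreover have "card (f ` {a \<in> A. t < f a}) = card {a \<in> A. t < f a}"
    by (rule card_image) (rule inj_on_subset[OF inj], auto)
  ultimately show ?thesis by (simp add: f_def)
qed

text \<open>The last of \<open>m\<close> objects is rejected exactly if it is none of the \<open>t m\<close> smallest, which leaves
  \<open>m - t m\<close> choices for it; whichever it is, the objects before it form an ordering of a set with
  \<open>m - 1\<close> elements. The count depends on the set only through its size, and this is what makes past
  rejections independent of which objects have been seen. The subtraction is truncated: a level
  \<open>t k \<ge> k\<close> accepts every object at position \<open>k\<close> and contributes a factor zero.\<close>

lemma card_all_rejected:
  fixes A :: "'a::linorder set"
  assumes "finite A"
  shows "card {xs \<in> permutations_of_set A. all_rejected t xs} = (\<Prod>k=1..card A. k - t k)"
  using assms
proof (induction "card A" arbitrary: A)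
  case 0
  then have "A = {}" by simp
  moreover have "{xs \<in> permutations_of_set {}. all_rejected t xs} = {[] :: 'a list}"
    by (auto simp: all_rejected_def)
  ultimately show ?case by simp
next
  case (Suc m)
  define L where "L = {a \<in> A. t (Suc m) < card {x \<in> A. x \<le> a}}"
  define R where "R B = {xs \<in> permutations_of_set B. all_rejected t xs}" for B :: "'a set"
  have fin: "finite L" "finite (R B)" for B
    using Suc.prems by (auto simp: L_def R_def)
  have "R A = (\<lambda>(a, xs). xs @ [a]) ` (SIGMA a:L. R (A - {a}))"
  proof (intro equalityI subsetI)
    fix ys assume ys: "ys \<in> R A"
    then have set_ys: "set ys = A" "distinct ys" "all_rejected t ys"
      by (auto simp: R_def permutations_of_set_def)
    then have "length ys = Suc m" using Suc.hyps distinct_card by fastforce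
    then obtain xs a where xs: "ys = xs @ [a]" "length xs = m"
      by (metis length_Suc_conv_rev)
    with set_ys have "set xs = A - {a}" "distinct xs" "a \<in> A" "insert a (set xs) = A"
      by auto
    with set_ys xs have "(a, xs) \<in> (SIGMA a:L. R (A - {a}))"
      by (auto simp: L_def R_def permutations_of_set_def all_rejected_snoc)
    with xs show "ys \<in> (\<lambda>(a, xs). xs @ [a]) ` (SIGMA a:L. R (A - {a}))" by force
  next
    fix ys assume "ys \<in> (\<lambda>(a, xs). xs @ [a]) ` (SIGMA a:L. R (A - {a}))"
    then obtain a xs where ys: "ys = xs @ [a]" "a \<in> L" "xs \<in> R (A - {a})" by auto
    then have "set xs = A - {a}" "distinct xs" "a \<in> A" "insert a (set xs) = A"
      by (auto simp: R_def L_def permutations_of_set_def)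
    moreover from this have "length xs = m"
      using Suc.hyps Suc.prems distinct_card[of xs] by simp
    ultimately show "ys \<in> R A"
      using ys by (auto simp: R_def L_def permutations_of_set_def all_rejected_snoc)
  qed
  moreover have "inj_on (\<lambda>(a, xs). xs @ [a]) (SIGMA a:L. R (A - {a}))"
    by (auto simp: inj_on_def)
  ultimately have "card (R A) = (\<Sum>a\<in>L. card (R (A - {a})))"
    using fin by (simp add: card_image card_SigmaI)
  also have "\<dots> = (\<Sum>a\<in>L. \<Prod>k=1..m. k - t k)"
  proof (intro sum.cong refl)
    fix a assume "a \<in> L"
    then have "m = card (A - {a})" using Suc.hyps Suc.prems by (simp add: L_def)
    with Suc.hyps(1)[OF this] Suc.prems show "card (R (A - {a})) = (\<Prod>k=1..m. k - t k)"
      by (simp add: R_def)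
  qed
  also have "\<dots> = (\<Prod>k=1..Suc m. k - t k)"
    using card_rank_greater[OF Suc.prems, of "t (Suc m)"]
    by (simp add: L_def Suc.hyps(2)[symmetric] mult.commute)
  finally show ?case using Suc.hyps(2) by (simp add: R_def)
qed

section \<open>Acceptance of an object of given absolute rank\<close>

text \<open>The possible sets of objects that arrive before position \<open>i\<close> when the object at position \<open>i\<close> has
  absolute rank \<open>j\<close> and relative rank at most \<open>r\<close>: fewer than \<open>r\<close> of its predecessors are better.\<close>

definition prior_sets :: "nat \<Rightarrow> nat \<Rightarrow> nat \<Rightarrow> nat \<Rightarrow> nat set set" where
  "prior_sets n i j r =
     {A. A \<subseteq> {1..n} - {j} \<and> card A = i - 1 \<and> card {x \<in> A. x < j} < r}"

lemma finite_prior_sets [simp]: "finite (prior_sets n i j r)"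
  by (rule finite_subset[of _ "Pow {1..n}"]) (auto simp: prior_sets_def)

lemma card_insert_le_eq:
  fixes j :: "'a::linorder"
  assumes "finite A" "j \<notin> A"
  shows "card {x \<in> insert j A. x \<le> j} = Suc (card {x \<in> A. x < j})"
proof -
  have "{x \<in> insert j A. x \<le> j} = insert j {x \<in> A. x < j}"
    using assms by (auto simp: less_le)
  then show ?thesis using assms by simp
qed

text \<open>An arrival order splits uniquely into the objects \<open>ys\<close> before position \<open>i\<close>, the object \<open>j\<close> at
  position \<open>i\<close> and the objects \<open>zs\<close> after it. The rank of \<open>j\<close> constrains only \<open>set ys\<close>, and rejection
  of all earlier objects constrains only the order of \<open>ys\<close>, so the count factorizes.\<close>

lemma card_first_accepted_list:
  assumes i: "1 \<le> i" "i \<le> n" and b: "b \<le> n"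
  shows "card {xs \<in> permutations_of_set {1..n}. xs ! (i - 1) \<le> b \<and>
            rank_at xs (i - 1) \<le> t i \<and> (\<forall>k<i - 1. t (Suc k) < rank_at xs k)}
       = (\<Sum>j=1..b. card (prior_sets n i j (t i))) * (\<Prod>k=1..i - 1. k - t k) * fact (n - i)"
    (is "card ?W = _")
proof -
  define R where "R A = {xs \<in> permutations_of_set A. all_rejected t xs}" for A :: "nat set"
  define rest where "rest j A = permutations_of_set ({1..n} - {j} - A)" for j and A :: "nat set"
  let ?S = "SIGMA j:{1..b}. SIGMA A:prior_sets n i j (t i). R A \<times> rest j A"
  let ?g = "\<lambda>(j, A, ys, zs). ys @ j # zs"
  have A_props: "finite A" "j \<notin> A" "A \<subseteq> {1..n}" "card A = i - 1" if "A \<in> prior_sets n i j r" for A j r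
    using that by (auto simp: prior_sets_def intro: finite_subset)
  have "?W = ?g ` ?S"
  proof (intro equalityI subsetI)
    fix xs assume W: "xs \<in> ?W"
    then have xs: "set xs = {1..n}" "distinct xs" by (auto simp: permutations_of_set_def)
    then have len: "length xs = n" using distinct_card by fastforce
    define ys j zs where "ys = take (i - 1) xs" and "j = xs ! (i - 1)" and "zs = drop i xs"
    have split: "xs = ys @ j # zs"
      using i len id_take_nth_drop[of "i - 1" xs] by (simp add: ys_def j_def zs_def)
    have len_ys: "length ys = i - 1" using i len by (simp add: ys_def)
    have dist: "distinct ys" "distinct zs" "j \<notin> set ys" "set zs = {1..n} - {j} - set ys"
      "j \<in> {1..n}" "set ys \<subseteq> {1..n} - {j}"
      using xs split by auto
    have cys: "card (set ys) = i - 1" using dist distinct_card len_ys by metis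
    have "rank_at xs (i - 1) = Suc (card {x \<in> set ys. x < j})"
      using rank_at_length[of ys j zs] split len_ys dist card_insert_le_eq[of "set ys" j] by simp
    then have "set ys \<in> prior_sets n i j (t i)"
      using W dist cys by (auto simp: prior_sets_def)
    moreover have "all_rejected t ys"
      using W len_ys by (auto simp: all_rejected_def split rank_at_append)
    moreover have "j \<le> b" using W by (simp add: j_def)
    ultimately have "(j, set ys, ys, zs) \<in> ?S"
      using dist by (auto simp: R_def rest_def permutations_of_set_def)
    then show "xs \<in> ?g ` ?S" using split by force
  next
    fix xs assume "xs \<in> ?g ` ?S"
    then obtain j A ys zs where *: "xs = ys @ j # zs" "j \<in> {1..b}"
      "A \<in> prior_sets n i j (t i)" "ys \<in> R A" "zs \<in> rest j A" by auto
    note A = A_props[OF *(3)]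
    have ys: "set ys = A" "distinct ys" "all_rejected t ys"
      and zs: "set zs = {1..n} - {j} - A" "distinct zs"
      using * by (auto simp: R_def rest_def permutations_of_set_def)
    have len_ys: "length ys = i - 1" using ys A distinct_card by metis
    have "set xs = {1..n}" using * ys zs A b by auto
    moreover have "distinct xs" using * ys zs A by auto
    moreover have "xs ! (i - 1) = j" using * len_ys by (metis nth_append_length)
    moreover have "rank_at xs (i - 1) = Suc (card {x \<in> A. x < j})"
      using rank_at_length[of ys j zs] * len_ys ys A card_insert_le_eq[of A j] by simp
    moreover have "\<forall>k<i - 1. t (Suc k) < rank_at xs k"
      using ys(3) len_ys * by (auto simp: all_rejected_def rank_at_append)
    ultimately show "xs \<in> ?W"
      using * by (auto simp: permutations_of_set_def prior_sets_def)
  qed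
  moreover have "inj_on ?g ?S"
  proof (rule inj_onI, clarsimp)
    fix j A ys zs j' A' ys' zs'
    assume *: "A \<in> prior_sets n i j (t i)" "ys \<in> R A" "A' \<in> prior_sets n i j' (t i)" "ys' \<in> R A'"
      "ys @ j # zs = ys' @ j' # zs'"
    then have "set ys = A" "set ys' = A'" "length ys = length ys'"
      using A_props[OF *(1)] A_props[OF *(3)] distinct_card[of ys] distinct_card[of ys']
      by (auto simp: R_def permutations_of_set_def)
    then show "j = j' \<and> A = A' \<and> ys = ys' \<and> zs = zs'" using * by auto
  qed
  moreover have "card ?S = (\<Sum>j=1..b. card (prior_sets n i j (t i)) * ((\<Prod>k=1..i - 1. k - t k) * fact (n - i)))"
  proof -
    have "card ?S = (\<Sum>j=1..b. \<Sum>A\<in>prior_sets n i j (t i). card (R A) * card (rest j A))"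
      by (subst card_SigmaI)
         (auto simp: R_def rest_def card_cartesian_product intro!: sum.cong card_SigmaI)
    also have "\<dots> = (\<Sum>j=1..b. \<Sum>A\<in>prior_sets n i j (t i). (\<Prod>k=1..i - 1. k - t k) * fact (n - i))"
    proof (intro sum.cong refl)
      fix j A assume j: "j \<in> {1..b}" and A: "A \<in> prior_sets n i j (t i)"
      have "card ({1..n} - {j} - A) = n - 1 - (i - 1)"
        using A_props[OF A] j b by (subst card_Diff_subset) auto
      then have "card ({1..n} - {j} - A) = n - i" using i by simp
      moreover have "card (R A) = (\<Prod>k=1..i - 1. k - t k)"
        using card_all_rejected[of A t] A_props[OF A] by (simp add: R_def)
      ultimately show "card (R A) * card (rest j A) = (\<Prod>k=1..i - 1. k - t k) * fact (n - i)"
        by (simp add: rest_def)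
    qed
    finally show ?thesis by simp
  qed
  ultimately show ?thesis
    by (simp add: card_image sum_distrib_right mult.assoc)
qed

text \<open>The index \<open>k\<close> is the relative rank: \<open>k - 1\<close> of the \<open>i - 1\<close> predecessors are chosen among the \<open>j - 1\<close>
  better objects and \<open>i - k\<close> among the \<open>n - j\<close> worse ones. The terms with \<open>k > i\<close> belong to impossible
  relative ranks and are zero by the convention for negative lower indices.\<close>

lemma card_prior_sets:
  assumes "1 \<le> i" "1 \<le> j" "j \<le> n"
  shows "real (card (prior_sets n i j r)) =
    (\<Sum>k=1..r. zbinom (j - 1) (int k - 1) * zbinom (n - j) (int i - int k))"
proof -
  define T where "T k = {A. A \<subseteq> {1..n} - {j} \<and> card A = i - 1 \<and> card {x \<in> A. x < j} = k - 1}" for k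
  have finT: "finite (T k)" for k
    by (rule finite_subset[of _ "Pow {1..n}"]) (auto simp: T_def)
  have "prior_sets n i j r = (\<Union>k\<in>{1..r}. T k)"
  proof (intro equalityI subsetI)
    fix A assume "A \<in> prior_sets n i j r"
    then have "A \<in> T (Suc (card {x \<in> A. x < j}))" "Suc (card {x \<in> A. x < j}) \<in> {1..r}"
      by (auto simp: prior_sets_def T_def)
    then show "A \<in> (\<Union>k\<in>{1..r}. T k)" by blast
  qed (auto simp: prior_sets_def T_def)
  moreover have "card (\<Union>k\<in>{1..r}. T k) = (\<Sum>k=1..r. card (T k))"
    by (rule card_UN_disjoint) (use finT in \<open>auto simp: T_def\<close>)
  moreover have "real (card (T k)) = zbinom (j - 1) (int k - 1) * zbinom (n - j) (int i - int k)"
    if k: "k \<in> {1..r}" for k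
  proof (cases "k \<le> i")
    case True
    let ?P = "{B. B \<subseteq> {1..<j} \<and> card B = k - 1} \<times> {C. C \<subseteq> {j<..n} \<and> card C = i - k}"
    have "bij_betw (\<lambda>(B, C). B \<union> C) ?P (T k)"
    proof (rule bij_betwI[where g = "\<lambda>A. (A \<inter> {1..<j}, A \<inter> {j<..n})"])
      show "(\<lambda>(B, C). B \<union> C) \<in> ?P \<rightarrow> T k"
      proof (clarsimp)
        fix B C assume *: "B \<subseteq> {Suc 0..<j}" "C \<subseteq> {j<..n}" "card B = k - Suc 0" "card C = i - k"
        then have "finite B" "finite C" by (auto intro: finite_subset)
        moreover have "B \<inter> C = {}" using * by force
        moreover have "{x \<in> B \<union> C. x < j} = B" using * by force
        ultimately show "B \<union> C \<in> T k"
          using * True k assms by (auto simp: T_def card_Un_disjoint)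
      qed
      show "(\<lambda>A. (A \<inter> {1..<j}, A \<inter> {j<..n})) \<in> T k \<rightarrow> ?P"
      proof
        fix A assume A: "A \<in> T k"
        then have sub: "A \<subseteq> {1..n} - {j}" by (simp add: T_def)
        then have "finite A" by (auto intro: finite_subset)
        moreover have "A = (A \<inter> {1..<j}) \<union> (A \<inter> {j<..n})" using sub by force
        ultimately have "card A = card (A \<inter> {1..<j}) + card (A \<inter> {j<..n})"
          by (metis (no_types, lifting) card_Un_disjoint finite_Un disjoint_iff Int_iff
              atLeastLessThan_iff greaterThanAtMost_iff less_asym)
        moreover have "A \<inter> {1..<j} = {x \<in> A. x < j}" using sub by auto
        ultimately show "(A \<inter> {1..<j}, A \<inter> {j<..n}) \<in> ?P"
          using A k True by (auto simp: T_def)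
      qed
    qed (force simp: T_def)+
    then have "card (T k) = card ?P" by (simp add: bij_betw_same_card)
    also have "\<dots> = ((j - 1) choose (k - 1)) * ((n - j) choose (i - k))"
      by (simp add: card_cartesian_product n_subsets)
    finally show ?thesis
      using k True by (simp add: zbinom_def nat_diff_distrib' of_nat_diff[symmetric] del: of_nat_diff)
  next
    case False
    have "T k = {}"
    proof (rule ccontr)
      assume "T k \<noteq> {}"
      then obtain A where A: "A \<in> T k" by blast
      then have "finite A" by (auto simp: T_def intro: finite_subset)
      then have "card {x \<in> A. x < j} \<le> card A" by (auto intro: card_mono)
      with A False assms show False by (auto simp: T_def)
    qed
    then show ?thesis using False by (simp add: zbinom_def)
  qed
  ultimately show ?thesis by simp
qed

text \<open>Relative ranks never exceed absolute ranks, so for \<open>j \<le> r\<close> the rank condition is void.\<close>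

lemma card_prior_sets_unrestricted:
  assumes "1 \<le> j" "j \<le> n" "j \<le> r"
  shows "card (prior_sets n i j r) = (n - 1) choose (i - 1)"
proof -
  have "card {x \<in> A. x < j} < r" if "A \<subseteq> {1..n} - {j}" for A
  proof -
    have "card {x \<in> A. x < j} \<le> card {1..<j}" using that by (intro card_mono) auto
    then show ?thesis using assms by simp
  qed
  then have "prior_sets n i j r = {A. A \<subseteq> {1..n} - {j} \<and> card A = i - 1}"
    by (auto simp: prior_sets_def)
  then show ?thesis using assms by (simp add: n_subsets)
qed

section \<open>From lists to permutations\<close>

lemma bij_betw_permutes_permutations_of_set:
  "bij_betw (\<lambda>X. map X [1..<Suc n]) {X. X permutes {1..n}} (permutations_of_set {1..n})"
proof -
  let ?f = "\<lambda>X. map X [1..<Suc n]"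
  have inj: "inj_on ?f {X. X permutes {1..n}}"
  proof (rule inj_onI, clarsimp simp del: upt_Suc)
    fix X Y assume *: "X permutes {Suc 0..n}" "Y permutes {Suc 0..n}" "\<forall>x\<in>{Suc 0..<Suc n}. X x = Y x"
    show "X = Y"
    proof
      fix x show "X x = Y x"
        using * permutes_not_in[of X "{Suc 0..n}" x] permutes_not_in[of Y "{Suc 0..n}" x]
        by (cases "x \<in> {Suc 0..n}") auto
    qed
  qed
  have "?f ` {X. X permutes {1..n}} \<subseteq> permutations_of_set {1..n}"
    by (auto simp: permutations_of_set_def distinct_map atLeastLessThanSuc_atLeastAtMost
        permutes_image permutes_inj_on simp del: upt_Suc)
  then have "?f ` {X. X permutes {1..n}} = permutations_of_set {1..n}"
    by (intro card_subset_eq) (simp_all only: card_image[OF inj] card_permutations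
        card_permutations_of_set finite_permutations_of_set finite_atLeastAtMost)
  with inj show ?thesis by (simp add: bij_betw_def)
qed

lemma rank_at_map_permutes:
  assumes "X permutes {1..n}" "i < n"
  shows "rank_at (map X [1..<Suc n]) i = rel_rank X (Suc i)"
proof -
  have "set (take (Suc i) (map X [1..<Suc n])) = X ` {1..Suc i}"
    using assms by (simp add: take_map take_upt atLeastLessThanSuc_atLeastAtMost del: upt_Suc)
  moreover have "map X [1..<Suc n] ! i = X (Suc i)" using assms by (simp del: upt_Suc)
  ultimately have "rank_at (map X [1..<Suc n]) i = card {x \<in> X ` {1..Suc i}. x \<le> X (Suc i)}"
    unfolding rank_at_def by (simp del: upt_Suc)
  also have "{x \<in> X ` {1..Suc i}. x \<le> X (Suc i)} = X ` {k \<in> {1..Suc i}. X k \<le> X (Suc i)}"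
    by auto
  also have "card \<dots> = card {k \<in> {1..Suc i}. X k \<le> X (Suc i)}"
    using assms by (intro card_image) (rule permutes_inj_on)
  finally show ?thesis by (simp add: rel_rank_def)
qed

lemma card_first_accepted:
  assumes i: "1 \<le> i" "i \<le> n" and b: "b \<le> n"
  shows "card {X. X permutes {1..n} \<and> X i \<le> b \<and>
            rel_rank X i \<le> t i \<and> (\<forall>k\<in>{1..<i}. t k < rel_rank X k)}
       = (\<Sum>j=1..b. card (prior_sets n i j (t i))) * (\<Prod>k=1..i - 1. k - t k) * fact (n - i)"
proof -
  let ?f = "\<lambda>X. map X [1..<Suc n]"
  let ?Q = "\<lambda>xs. xs ! (i - 1) \<le> b \<and> rank_at xs (i - 1) \<le> t i \<and> (\<forall>k<i - 1. t (Suc k) < rank_at xs k)"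
  have Q: "?Q (?f X) \<longleftrightarrow> X i \<le> b \<and> rel_rank X i \<le> t i \<and> (\<forall>k\<in>{1..<i}. t k < rel_rank X k)"
    if X: "X permutes {1..n}" for X
  proof -
    have "?f X ! (i - 1) = X i" using i by (simp del: upt_Suc)
    moreover have "rank_at (?f X) (i - 1) = rel_rank X i"
      using rank_at_map_permutes[OF X, of "i - 1"] i by (simp del: upt_Suc)
    moreover have "(\<forall>k<i - 1. t (Suc k) < rank_at (?f X) k) \<longleftrightarrow> (\<forall>k<i - 1. t (Suc k) < rel_rank X (Suc k))"
      using rank_at_map_permutes[OF X] i by (simp del: upt_Suc)
    moreover have "\<dots> \<longleftrightarrow> (\<forall>k\<in>Suc ` {..<i - 1}. t k < rel_rank X k)" by auto
    moreover have "Suc ` {..<i - 1} = {1..<i}"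
      using i by (simp add: lessThan_atLeast0 image_Suc_atLeastLessThan)
    ultimately show ?thesis by (simp only:)
  qed
  have "bij_betw ?f {X \<in> {X. X permutes {1..n}}. ?Q (?f X)} {xs \<in> permutations_of_set {1..n}. ?Q xs}"
    using bij_betw_permutes_permutations_of_set[of n]
    by (auto simp: bij_betw_def simp del: upt_Suc intro: inj_on_subset)
  from bij_betw_same_card[OF this]
  have "card {X. X permutes {1..n} \<and> ?Q (?f X)} = card {xs \<in> permutations_of_set {1..n}. ?Q xs}"
    by simp
  also have "{X. X permutes {1..n} \<and> ?Q (?f X)} = {X. X permutes {1..n} \<and> X i \<le> b \<and>
            rel_rank X i \<le> t i \<and> (\<forall>k\<in>{1..<i}. t k < rel_rank X k)}"
    using Q by blast
  finally show ?thesis using card_first_accepted_list[OF assms] by simp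
qed

section \<open>Probability of winning at a given position\<close>

text \<open>The probability that none of the first \<open>m\<close> objects is accepted: the relative ranks are independent,
  and the one at position \<open>k\<close> is uniform on \<open>{1..k}\<close>.\<close>

definition survival :: "(nat \<Rightarrow> nat) \<Rightarrow> nat \<Rightarrow> real" where
  "survival t m = (\<Prod>k=1..m. real (k - t k) / real k)"

lemma survival_eq: "survival t m = real (\<Prod>k=1..m. k - t k) / fact m"
proof -
  have "(fact m :: real) = (\<Prod>k=1..m. real k)"
    unfolding fact_prod of_nat_prod by simp
  then show ?thesis unfolding survival_def prod_dividef of_nat_prod by simp
qed

text \<open>The probability that the object at position \<open>i\<close> has absolute rank at most \<open>b\<close> and relative rank
  at most \<open>r\<close>: each absolute rank \<open>j\<close> has probability \<open>1/n\<close>, and given \<open>j\<close> the set of predecessors is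
  uniform among the \<open>(i - 1)\<close>-subsets of the other \<open>n - 1\<close> objects.\<close>

definition hit_prob :: "nat \<Rightarrow> nat \<Rightarrow> nat \<Rightarrow> nat \<Rightarrow> real" where
  "hit_prob n b i r = 1 / real n *
     (\<Sum>j=1..b. real (card (prior_sets n i j r)) / real ((n - 1) choose (i - 1)))"

text \<open>Division of the factorized count by \<open>n!\<close> turns it into a product of two probabilities: the past
  rejections are independent of the absolute and relative rank of the current object.\<close>

lemma prob_first_accepted:
  assumes i: "1 \<le> i" "i \<le> n" and b: "b \<le> n"
  shows "measure_pmf.prob (pmf_of_set {X. X permutes {1..n}})
           {X. X i \<le> b \<and> rel_rank X i \<le> t i \<and> (\<forall>k\<in>{1..<i}. t k < rel_rank X k)}
       = survival t (i - 1) * hit_prob n b i (t i)"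
    (is "measure_pmf.prob ?U ?E = _")
proof -
  let ?S = "{X. X permutes {1..n}}"
  have S: "finite ?S" "?S \<noteq> {}" "card ?S = fact n"
    using permutes_id[of "{1..n}"] by (auto simp: finite_permutations card_permutations simp del: permutes_id)
  have "?S \<inter> ?E = {X. X permutes {1..n} \<and> X i \<le> b \<and>
            rel_rank X i \<le> t i \<and> (\<forall>k\<in>{1..<i}. t k < rel_rank X k)}" by auto
  then have "measure_pmf.prob ?U ?E = real ((\<Sum>j=1..b. card (prior_sets n i j (t i)))
      * (\<Prod>k=1..i - 1. k - t k) * fact (n - i)) / fact n"
    using card_first_accepted[OF assms, of t] S by (simp add: measure_pmf_of_set)
  also have "\<dots> = survival t (i - 1) * (fact (i - 1) * fact (n - i) / fact n)
      * (\<Sum>j=1..b. real (card (prior_sets n i j (t i))))"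
    by (simp add: survival_eq)
  also have "(fact (i - 1) * fact (n - i) / fact n :: real) = 1 / real n / real ((n - 1) choose (i - 1))"
  proof -
    have "real ((n - 1) choose (i - 1)) = fact (n - 1) / (fact (i - 1) * fact (n - i))"
      using i binomial_fact[of "i - 1" "n - 1", where 'a = real] by simp
    moreover have "fact n = real n * fact (n - 1)"
      using i fact_reduce[of n, where 'a = real] by simp
    ultimately show ?thesis by simp
  qed
  finally show ?thesis
    by (simp add: hit_prob_def flip: sum_divide_distrib)
qed

text \<open>The terms with \<open>j \<le> r\<close> are 1 each and make up \<open>r/n\<close>.\<close>

lemma hit_prob_eq:
  assumes "1 \<le> i" "i \<le> n" "r \<le> b" "b \<le> n"
  shows "hit_prob n b i r = real r / real n + 1 / real n *
            (\<Sum>j=r+1..b. \<Sum>k=1..r.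
               zbinom (j - 1) (int k - 1) * zbinom (n - j) (int i - int k)
                 / zbinom (n - 1) (int i - 1))"
proof -
  let ?c = "real ((n - 1) choose (i - 1))"
  let ?f = "\<lambda>j. real (card (prior_sets n i j r)) / ?c"
  have c: "?c \<noteq> 0" "zbinom (n - 1) (int i - 1) = ?c"
    using assms by (auto simp: zbinom_def nat_diff_distrib')
  have "{1..b} = {1..r} \<union> {r+1..b}" "{1..r} \<inter> {r+1..b} = {}" using assms by auto
  then have "(\<Sum>j=1..b. ?f j) = (\<Sum>j=1..r. ?f j) + (\<Sum>j=r+1..b. ?f j)"
    by (simp only: sum.union_disjoint finite_atLeastAtMost)
  also have "(\<Sum>j=1..r. ?f j) = (\<Sum>j=1..r. 1)"
    using assms c(1) by (intro sum.cong refl) (simp add: card_prior_sets_unrestricted)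
  also have "(\<Sum>j=r+1..b. ?f j) = (\<Sum>j=r+1..b. \<Sum>k=1..r.
               zbinom (j - 1) (int k - 1) * zbinom (n - j) (int i - int k) / ?c)"
    using assms by (intro sum.cong refl) (simp add: card_prior_sets sum_divide_distrib)
  finally show ?thesis unfolding hit_prob_def c(2) by (simp add: add_divide_distrib)
qed

lemma hit_prob_unrestricted:
  assumes "1 \<le> i" "i \<le> n" "b \<le> n"
  shows "hit_prob n b i n = real b / real n"
proof -
  have "(\<Sum>j=1..b. real (card (prior_sets n i j n)) / real ((n - 1) choose (i - 1))) = (\<Sum>j=1..b. 1)"
    using assms by (intro sum.cong refl) (simp add: card_prior_sets_unrestricted)
  then show ?thesis unfolding hit_prob_def by simp
qed

lemma hit_prob_0: "hit_prob n b i 0 = 0"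
  by (simp add: hit_prob_def prior_sets_def)

section \<open>The double-level policy\<close>

text \<open>The policy accepts the first object whose relative rank is at most the level of its position:
  level 0 accepts nothing in the initial phase, and level \<open>n\<close> at position \<open>n\<close> expresses that the last
  object is picked whatever its rank.\<close>

definition dlp_level :: "nat \<Rightarrow> nat \<times> nat \<Rightarrow> nat \<times> nat \<Rightarrow> nat \<Rightarrow> nat" where
  "dlp_level n = (\<lambda>(s\<^sub>1, s\<^sub>2) (r\<^sub>1, r\<^sub>2) i.
     if i \<le> s\<^sub>1 then 0 else if i \<le> s\<^sub>2 then r\<^sub>1 else if i < n then r\<^sub>2 else n)"

lemma dlp_pick_first_accepted:
  fixes n s\<^sub>1 s\<^sub>2 r\<^sub>1 r\<^sub>2 X
  defines "p \<equiv> dlp_pick n (s\<^sub>1, s\<^sub>2) (r\<^sub>1, r\<^sub>2) X" and "t \<equiv> dlp_level n (s\<^sub>1, s\<^sub>2) (r\<^sub>1, r\<^sub>2)"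
  assumes s: "s\<^sub>1 < s\<^sub>2" "s\<^sub>2 < n"
  shows "p \<in> {1..n} \<and> rel_rank X p \<le> t p \<and> (\<forall>k\<in>{1..<p}. t k < rel_rank X k)"
proof -
  have pos: "0 < rel_rank X k" if "1 \<le> k" for k
    using that by (auto simp: rel_rank_def card_gt_0_iff)
  have last: "rel_rank X n \<le> n"
    unfolding rel_rank_def
    using card_mono[of "{1..n}" "{k \<in> {1..n}. X k \<le> X n}"] by (simp add: subset_iff)
  let ?P1 = "\<lambda>i. i \<in> {s\<^sub>1+1..s\<^sub>2} \<and> rel_rank X i \<le> r\<^sub>1"
  let ?P2 = "\<lambda>i. i \<in> {s\<^sub>2+1..n-1} \<and> rel_rank X i \<le> r\<^sub>2"
  consider (first) "\<exists>i. ?P1 i" | (second) "\<nexists>i. ?P1 i" "\<exists>i. ?P2 i" | (neither) "\<nexists>i. ?P1 i" "\<nexists>i. ?P2 i"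
    by blast
  then show ?thesis
  proof cases
    case first
    then have p: "p = (LEAST i. ?P1 i)" by (auto simp: p_def dlp_pick_def)
    have "?P1 p" using first unfolding p by (rule LeastI_ex)
    moreover have "r\<^sub>1 < rel_rank X k" if "s\<^sub>1 < k" "k < p" for k
      using not_less_Least[of k ?P1, folded p] that \<open>?P1 p\<close> by auto
    ultimately show ?thesis using pos s by (auto simp: t_def dlp_level_def not_le)
  next
    case second
    then have p: "p = (LEAST i. ?P2 i)" by (auto simp: p_def dlp_pick_def)
    have "?P2 p" using second(2) unfolding p by (rule LeastI_ex)
    moreover have "r\<^sub>2 < rel_rank X k" if "s\<^sub>2 < k" "k < p" for k
      using not_less_Least[of k ?P2, folded p] that \<open>?P2 p\<close> by auto
    moreover have "r\<^sub>1 < rel_rank X k" if "s\<^sub>1 < k" "k \<le> s\<^sub>2" for k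
      using second(1) that by (metis Suc_eq_plus1 Suc_leI atLeastAtMost_iff not_le)
    ultimately show ?thesis using pos s by (auto simp: t_def dlp_level_def not_le)
  next
    case neither
    then have "p = n" by (auto simp: p_def dlp_pick_def)
    moreover have "r\<^sub>1 < rel_rank X k" if "s\<^sub>1 < k" "k \<le> s\<^sub>2" for k
      using neither(1) that by (metis Suc_eq_plus1 Suc_leI atLeastAtMost_iff not_le)
    moreover have "r\<^sub>2 < rel_rank X k" if "s\<^sub>2 < k" "k < n" for k
    proof -
      have "k \<in> {s\<^sub>2+1..n-1}" using that by auto
      then show ?thesis using neither(2) by (meson not_le)
    qed
    ultimately show ?thesis using pos last s by (auto simp: t_def dlp_level_def)
  qed
qed

lemma P_DLP_eq_sum:
  fixes n b s\<^sub>1 s\<^sub>2 r\<^sub>1 r\<^sub>2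
  defines "t \<equiv> dlp_level n (s\<^sub>1, s\<^sub>2) (r\<^sub>1, r\<^sub>2)"
  assumes s: "s\<^sub>1 < s\<^sub>2" "s\<^sub>2 < n" and b: "b \<le> n"
  shows "P_DLP n b (s\<^sub>1, s\<^sub>2) (r\<^sub>1, r\<^sub>2) = (\<Sum>i=1..n. survival t (i - 1) * hit_prob n b i (t i))"
proof -
  let ?E = "\<lambda>i. {X. X i \<le> b \<and> rel_rank X i \<le> t i \<and> (\<forall>k\<in>{1..<i}. t k < rel_rank X k)}"
  let ?p = "dlp_pick n (s\<^sub>1, s\<^sub>2) (r\<^sub>1, r\<^sub>2)"
  have first: "?p X \<in> {1..n}" "rel_rank X (?p X) \<le> t (?p X)" "\<forall>k\<in>{1..<?p X}. t k < rel_rank X k" for X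
    using dlp_pick_first_accepted[OF s] by (simp_all add: t_def)
  have "?p X = i" if "i \<in> {1..n}" "X \<in> ?E i" for i X
  proof (rule ccontr)
    assume "?p X \<noteq> i"
    then consider "?p X < i" | "i < ?p X" by linarith
    then show False
    proof cases
      case 1
      then have "?p X \<in> {1..<i}" using first(1)[of X] by simp
      then have "t (?p X) < rel_rank X (?p X)" using that(2) by blast
      then show False using first(2)[of X] by simp
    next
      case 2
      then have "i \<in> {1..<?p X}" using that(1) by simp
      then have "t i < rel_rank X i" using first(3)[of X] by blast
      then show False using that(2) by simp
    qed
  qed
  note eq = this
  have "X \<in> ?E (?p X)" if "X (?p X) \<le> b" for X using first[of X] that by blast
  moreover have "X (?p X) \<le> b" if "i \<in> {1..n}" "X \<in> ?E i" for i X
    using eq[OF that] that(2) by simp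
  ultimately have "{X. X (?p X) \<le> b} = (\<Union>i\<in>{1..n}. ?E i)"
    using first(1) by (intro equalityI subsetI) (blast, fast)
  moreover have "disjoint_family_on ?E {1..n}"
    unfolding disjoint_family_on_def using eq by (metis (no_types, lifting) disjoint_iff)
  ultimately have "P_DLP n b (s\<^sub>1, s\<^sub>2) (r\<^sub>1, r\<^sub>2) =
      (\<Sum>i=1..n. measure_pmf.prob (pmf_of_set {X. X permutes {1..n}}) (?E i))"
    unfolding P_DLP_def by (simp only: measure_pmf.finite_measure_finite_Union finite_atLeastAtMost
        sets_measure_pmf subset_UNIV)
  also have "\<dots> = (\<Sum>i=1..n. survival t (i - 1) * hit_prob n b i (t i))"
    using prob_first_accepted b by (intro sum.cong refl) auto
  finally show ?thesis .
qed

lemma ffact_eq_fact: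
  assumes "r \<le> m"
  shows "ffact (real m) r = fact m / fact (m - r)"
  using assms
proof (induction r)
  case (Suc r)
  have "fact (m - r) = real (m - r) * fact (m - Suc r)"
    using Suc.prems fact_reduce[of "m - r", where 'a = real] by simp
  with Suc show ?case by (simp add: ffact_def of_nat_diff)
qed (simp add: ffact_def)

lemma ffact_eq_0:
  assumes "m < r"
  shows "ffact (real m) r = 0"
  using assms by (auto simp: ffact_def)

text \<open>While the level stays at \<open>r\<close>, the factors \<open>(k - r)/k\<close> for \<open>s < k \<le> m\<close> telescope to a quotient of
  falling factorials.\<close>

lemma survival_level:
  assumes "r \<le> s" "s \<le> m" and "\<And>k. s < k \<Longrightarrow> k \<le> m \<Longrightarrow> t k = r"
  shows "survival t m = survival t s * (ffact (real s) r / ffact (real m) r)"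
  using assms(2,1,3)
proof (induction m rule: dec_induct)
  case base
  then show ?case by (simp add: ffact_eq_fact)
next
  case (step m)
  define d where "d = real (Suc m - r)"
  have "(fact (Suc m - r) :: real) = d * fact (m - r)" and d: "d > 0"
    using step.hyps step.prems by (simp_all add: Suc_diff_le d_def)
  then have "ffact (real (Suc m)) r * d = ffact (real m) r * real (Suc m)"
    using step.hyps step.prems by (simp add: ffact_eq_fact del: of_nat_Suc)
  moreover have "ffact (real m) r > 0" "ffact (real (Suc m)) r > 0"
    using step.hyps step.prems by (simp_all add: ffact_eq_fact del: of_nat_Suc)
  ultimately have ratio: "ffact (real s) r / ffact (real m) r * (d / real (Suc m))
      = ffact (real s) r / ffact (real (Suc m)) r"
    using d by (simp add: frac_eq_eq mult.commute del: of_nat_Suc)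
  have "survival t (Suc m) = survival t m * (d / real (Suc m))"
    using step.hyps step.prems by (simp add: survival_def d_def)
  also have "survival t m = survival t s * (ffact (real s) r / ffact (real m) r)"
    using step by simp
  finally show ?case using ratio by (simp only: mult.assoc)
qed

text \<open>Telescoping over the two phases. If \<open>r\<^sub>2 > s\<^sub>2\<close>, every object at position \<open>s\<^sub>2 + 1\<close> is
  accepted and the factor for \<open>k = s\<^sub>2 + 1\<close> is zero; beyond \<open>s\<^sub>2\<close> the survival probability then
  vanishes, in agreement with the case distinction in \<open>ffact_quot\<close>.\<close>

lemma survival_dlp:
  fixes n s\<^sub>1 s\<^sub>2 r\<^sub>1 r\<^sub>2
  defines "t \<equiv> dlp_level n (s\<^sub>1, s\<^sub>2) (r\<^sub>1, r\<^sub>2)"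
  assumes s: "r\<^sub>1 \<le> s\<^sub>1" "s\<^sub>1 < s\<^sub>2" "s\<^sub>2 < n" and r: "r\<^sub>1 < r\<^sub>2"
  shows survival_dlp_first:
      "s\<^sub>1 \<le> m \<Longrightarrow> m \<le> s\<^sub>2 \<Longrightarrow> survival t m = ffact (real s\<^sub>1) r\<^sub>1 / ffact (real m) r\<^sub>1"
    and survival_dlp_second:
      "s\<^sub>2 \<le> m \<Longrightarrow> m < n \<Longrightarrow> survival t m = ffact_quot (s\<^sub>1, s\<^sub>2) (r\<^sub>1, r\<^sub>2) m"
proof -
  have t1: "t k = 0" if "k \<le> s\<^sub>1" for k using that by (simp add: t_def dlp_level_def)
  have t2: "t k = r\<^sub>1" if "s\<^sub>1 < k" "k \<le> s\<^sub>2" for k using that by (simp add: t_def dlp_level_def)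
  have t3: "t k = r\<^sub>2" if "s\<^sub>2 < k" "k < n" for k using that s by (simp add: t_def dlp_level_def)
  have "survival t s\<^sub>1 = 1"
    unfolding survival_def by (rule prod.neutral) (simp add: t1)
  then show first: "survival t m = ffact (real s\<^sub>1) r\<^sub>1 / ffact (real m) r\<^sub>1" if "s\<^sub>1 \<le> m" "m \<le> s\<^sub>2" for m
    using survival_level[OF s(1) that(1), of t] t2 that by simp
  show "survival t m = ffact_quot (s\<^sub>1, s\<^sub>2) (r\<^sub>1, r\<^sub>2) m" if m: "s\<^sub>2 \<le> m" "m < n"
  proof (cases "r\<^sub>2 \<le> s\<^sub>2")
    case True
    have "ffact (real s\<^sub>2) r\<^sub>2 = ffact (real s\<^sub>2) r\<^sub>1 * ffact (real s\<^sub>2 - real r\<^sub>1) (r\<^sub>2 - r\<^sub>1)"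
      using True r ffact_eq_fact[of "r\<^sub>2 - r\<^sub>1" "s\<^sub>2 - r\<^sub>1"] by (simp add: ffact_eq_fact of_nat_diff)
    moreover have "ffact (real s\<^sub>2) r\<^sub>1 \<noteq> 0" using True r by (simp add: ffact_eq_fact)
    moreover have "survival t m = survival t s\<^sub>2 * (ffact (real s\<^sub>2) r\<^sub>2 / ffact (real m) r\<^sub>2)"
      using survival_level[OF True m(1), of t] t3 m by simp
    ultimately show ?thesis
      using first[of s\<^sub>2] s True m by (simp add: ffact_quot_def)
  next
    case False
    show ?thesis
    proof (cases "m = s\<^sub>2")
      case True
      then show ?thesis using first[of s\<^sub>2] s False by (simp add: ffact_quot_def)
    next
      case neq: False
      have "Suc s\<^sub>2 - t (Suc s\<^sub>2) = 0" using t3[of "Suc s\<^sub>2"] neq m False by simp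
      then have "survival t m = 0"
        unfolding survival_def using neq m by (intro prod_zero bexI[of _ "Suc s\<^sub>2"]) auto
      moreover have "ffact (real s\<^sub>2 - real r\<^sub>1) (r\<^sub>2 - r\<^sub>1) = 0"
        using ffact_eq_0[of "s\<^sub>2 - r\<^sub>1" "r\<^sub>2 - r\<^sub>1"] False r s by (simp add: of_nat_diff)
      ultimately show ?thesis using neq by (simp add: ffact_quot_def)
    qed
  qed
qed

theorem theorem5:
  fixes n b r\<^sub>1 r\<^sub>2 s\<^sub>1 s\<^sub>2 :: nat
  assumes "1 \<le> b" and "b \<le> n"
    and "1 \<le> r\<^sub>1" and "r\<^sub>1 < r\<^sub>2" and "r\<^sub>2 \<le> b"
    and "r\<^sub>1 \<le> s\<^sub>1" and "s\<^sub>1 < s\<^sub>2" and "s\<^sub>2 \<le> n - 1"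
  shows "P_DLP n b (s\<^sub>1, s\<^sub>2) (r\<^sub>1, r\<^sub>2) =
      (\<Sum>i=s\<^sub>1+1..s\<^sub>2. ffact (real s\<^sub>1) r\<^sub>1 / ffact (real i - 1) r\<^sub>1 *
         (real r\<^sub>1 / real n + 1 / real n *
            (\<Sum>j=r\<^sub>1+1..b. \<Sum>k=1..r\<^sub>1.
               zbinom (j - 1) (int k - 1) * zbinom (n - j) (int i - int k)
                 / zbinom (n - 1) (int i - 1))))
    + (\<Sum>i=s\<^sub>2+1..n-1. ffact_quot (s\<^sub>1, s\<^sub>2) (r\<^sub>1, r\<^sub>2) (i - 1) *
         (real r\<^sub>2 / real n + 1 / real n *
            (\<Sum>j=r\<^sub>2+1..b. \<Sum>k=1..r\<^sub>2.
               zbinom (j - 1) (int k - 1) * zbinom (n - j) (int i - int k)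
                 / zbinom (n - 1) (int i - 1))))
    + ffact_quot (s\<^sub>1, s\<^sub>2) (r\<^sub>1, r\<^sub>2) (n - 1) * (real b / real n)"
    (is "_ = (\<Sum>i=s\<^sub>1+1..s\<^sub>2. ?q1 i * ?h1 i) + (\<Sum>i=s\<^sub>2+1..n-1. ?q2 i * ?h2 i) + ?last")
proof -
  define t where "t = dlp_level n (s\<^sub>1, s\<^sub>2) (r\<^sub>1, r\<^sub>2)"
  define w where "w i = survival t (i - 1) * hit_prob n b i (t i)" for i
  have s2n: "s\<^sub>2 < n" using assms by linarith
  note surv = survival_dlp[OF \<open>r\<^sub>1 \<le> s\<^sub>1\<close> \<open>s\<^sub>1 < s\<^sub>2\<close> s2n \<open>r\<^sub>1 < r\<^sub>2\<close>, folded t_def]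
  have "P_DLP n b (s\<^sub>1, s\<^sub>2) (r\<^sub>1, r\<^sub>2) = (\<Sum>i=1..n. w i)"
    using P_DLP_eq_sum[OF \<open>s\<^sub>1 < s\<^sub>2\<close> s2n \<open>b \<le> n\<close>] by (simp add: w_def t_def)
  also have "{1..n} = {1..s\<^sub>1} \<union> {s\<^sub>1+1..s\<^sub>2} \<union> {s\<^sub>2+1..n-1} \<union> {n}"
    using assms by auto
  also have "(\<Sum>i\<in>\<dots>. w i) = (\<Sum>i=1..s\<^sub>1. w i) + (\<Sum>i=s\<^sub>1+1..s\<^sub>2. w i) + (\<Sum>i=s\<^sub>2+1..n-1. w i) + w n"
    using assms s2n by (subst sum.union_disjoint, simp, simp, force)+ simp
  also have "(\<Sum>i=1..s\<^sub>1. w i) = 0"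
    by (intro sum.neutral) (simp add: w_def t_def dlp_level_def hit_prob_0)
  also have "(\<Sum>i=s\<^sub>1+1..s\<^sub>2. w i) = (\<Sum>i=s\<^sub>1+1..s\<^sub>2. ?q1 i * ?h1 i)"
  proof (intro sum.cong refl)
    fix i assume i: "i \<in> {s\<^sub>1+1..s\<^sub>2}"
    then have "s\<^sub>1 \<le> i - 1" "i - 1 \<le> s\<^sub>2" by auto
    then have "survival t (i - 1) = ?q1 i" using surv(1)[of "i - 1"] i by (simp add: of_nat_diff)
    moreover have "hit_prob n b i (t i) = ?h1 i"
      using hit_prob_eq[of i n r\<^sub>1 b] i s2n assms by (simp add: t_def dlp_level_def)
    ultimately show "w i = ?q1 i * ?h1 i" by (simp only: w_def)
  qed
  also have "(\<Sum>i=s\<^sub>2+1..n-1. w i) = (\<Sum>i=s\<^sub>2+1..n-1. ?q2 i * ?h2 i)"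
  proof (intro sum.cong refl)
    fix i assume i: "i \<in> {s\<^sub>2+1..n-1}"
    then have "survival t (i - 1) = ?q2 i" using surv(2)[of "i - 1"] by auto
    moreover have "hit_prob n b i (t i) = ?h2 i"
      using hit_prob_eq[of i n r\<^sub>2 b] i s2n assms by (auto simp: t_def dlp_level_def)
    ultimately show "w i = ?q2 i * ?h2 i" by (simp only: w_def)
  qed
  also have "w n = ?last"
    using surv(2)[of "n - 1"] hit_prob_unrestricted[of n n b] assms s2n
    by (auto simp: w_def t_def dlp_level_def)
  finally show ?thesis by simp
qed

end
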